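(* Let $m\ge 1$ and let $\mathbf{q}=[q_1,\dots,q_m]'$ be a probability mass function with $m$-element support (the prior generator), i.e. $q_i>0$ for all $i$ and $\sum_{i=1}^m q_i=1$. For each integer $n\ge 1$ let $\mathcal{H}_n$ be the set of all occurrence vectors $\mathbf{n}=[n_1,\dots,n_m]'$ of non-negative integers with $\sum_{i=1}^m n_i=n$, and let $\hat{\mathbf{n}}^{(n)}\in\mathcal{H}_n$ be a most probable occurrence vector generated by $\mathbf{q}$, i.e. $$\hat{\mathbf{n}}^{(n)}\in\arg\max_{\mathbf{n}\in\mathcal{H}_n}\pi(\mathbf{n}\mid\mathbf{q}),\qquad \pi(\mathbf{n}\mid\mathbf{q})=\frac{n!}{n_1!\,n_2!\cdots n_m!}\prod_{i=1}^m q_i^{n_i}.$$ Let $\mathcal{P}$ be the set of all probability vectors $\mathbf{p}=[p_1,\dots,p_m]'$ ($p_i\ge 0$, $\sum_{i=1}^m p_i=1$), and let $$\hat{\mathbf{p}}=\arg\max_{\mathbf{p}\in\mathcal{P}}H(\mathbf{p},\mathbf{q}),\qquad H(\mathbf{p},\mathbf{q})=-\sum_{i=1}^m p_i\ln\left(\frac{p_i}{q_i}\right).$$ Then $$\lim_{n\to\infty}\frac{\hat{\mathbf{n}}^{(n)}}{n}=\hat{\mathbf{p}}.$$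
   Context: Convention: $0\ln 0=0$. $\pi(\mathbf{n}\mid\mathbf{q})$ is the probability of obtaining the vector of absolute frequencies $\mathbf{n}$ in $n$ independent draws from $\mathbf{q}$. $H(\mathbf{p},\mathbf{q})$ is the relative entropy of $\mathbf{p}$ on the generator $\mathbf{q}$, i.e. minus the $I$-divergence (Kullback–Leibler distance). *)

theory Defs
  imports "HOL-Analysis.Analysis"
begin

definition prob_vectors :: "(real ^ 'm) set" where
  "prob_vectors = {p. (\<forall>i. 0 \<le> p $ i) \<and> (\<Sum>i\<in>UNIV. p $ i) = 1}"

definition occurrence_vectors :: "nat \<Rightarrow> (nat ^ 'm) set" where
  "occurrence_vectors n = {\<nu>. (\<Sum>i\<in>UNIV. \<nu> $ i) = n}"

text \<open>The multinomial probability of the occurrence vector \<open>\<nu>\<close> under the generator \<open>q\<close>.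
  The number of draws is recovered from \<open>\<nu>\<close> as the sum of its components.\<close>

definition occ_prob :: "nat ^ 'm \<Rightarrow> real ^ 'm \<Rightarrow> real" where
  "occ_prob \<nu> q =
     fact (\<Sum>i\<in>UNIV. \<nu> $ i) / (\<Prod>i\<in>UNIV. fact (\<nu> $ i)) * (\<Prod>i\<in>UNIV. (q $ i) ^ (\<nu> $ i))"

text \<open>Relative entropy, with the sign opposite to the Kullback--Leibler divergence. A summand with
  \<open>p $ i = 0\<close> vanishes whatever the value of \<open>ln 0\<close>, as the convention \<open>0 ln 0 = 0\<close> demands.\<close>

definition rel_entropy :: "real ^ 'm \<Rightarrow> real ^ 'm \<Rightarrow> real" where
  "rel_entropy p q = - (\<Sum>i\<in>UNIV. p $ i * ln (p $ i / q $ i))"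

end

theory Submission
  imports Defs
begin

text \<open>By Gibbs' inequality the unique maximiser of the relative entropy is the generator \<open>q\<close> itself.
  A most probable occurrence vector \<open>\<nu>\<close> cannot gain from moving one draw from \<open>i\<close> to \<open>j\<close>, which says
  \<open>q\<^sub>j \<nu>\<^sub>i \<le> q\<^sub>i (\<nu>\<^sub>j + 1)\<close>. Summing this over \<open>j\<close> and over \<open>i\<close> respectively gives
  \<open>n q\<^sub>i - 1 \<le> \<nu>\<^sub>i \<le> (n + m) q\<^sub>i\<close>, so \<open>\<nu>\<^sub>i / n\<close> converges to \<open>q\<^sub>i\<close>, with no need for
  Stirling's formula.\<close>

text \<open>This is the tangent bound \<open>ln x \<le> x - 1\<close> at \<open>x = q / p\<close>,
  multiplied by \<open>p\<close>; equality forces \<open>x = 1\<close>. The case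
  \<open>p = 0\<close> is separate since \<open>q / p\<close> makes no sense there, and
  \<open>0 < q\<close> then rules out equality.\<close>

lemma gibbs_term:
  fixes p q :: real
  assumes "0 \<le> p" and "0 < q"
  shows "p - q \<le> p * ln (p / q)"
    and "p * ln (p / q) = p - q \<longleftrightarrow> p = q"
proof -
  have *: "p - q \<le> p * ln (p / q) \<and> (p * ln (p / q) = p - q \<longleftrightarrow> p = q)"
  proof (cases "p = 0")
    case True
    then show ?thesis using assms by simp
  next
    case False
    with assms have p: "0 < p" by simp
    have ln: "p * ln (p / q) = - (p * ln (q / p))"
      using p assms by (simp add: ln_div algebra_simps)
    have "p * ln (q / p) \<le> p * (q / p - 1)"
      using p assms by (intro mult_left_mono ln_le_minus_one) auto
    moreover have "p * (q / p - 1) = q - p"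
      using p by (simp add: field_simps)
    moreover have "p = q" if "p * ln (p / q) = p - q"
    proof -
      have "p * ln (q / p) = p * (q / p - 1)"
        using that ln \<open>p * (q / p - 1) = q - p\<close> by linarith
      then have "ln (q / p) = q / p - 1" using p by simp
      then have "q / p = 1" using p assms by (intro ln_eq_minus_one) auto
      then show "p = q" using p by simp
    qed
    ultimately show ?thesis using ln p by auto
  qed
  then show "p - q \<le> p * ln (p / q)" and "p * ln (p / q) = p - q \<longleftrightarrow> p = q"
    by blast+
qed

lemma rel_entropy_nonneg_imp_eq:
  fixes p q :: "real ^ 'm"
  assumes p: "p \<in> prob_vectors" and q_pos: "\<And>i. 0 < q $ i" and q_sum: "(\<Sum>i\<in>UNIV. q $ i) = 1"
    and nonneg: "0 \<le> rel_entropy p q"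
  shows "p = q"
proof -
  \<comment> \<open>The slack in Gibbs' inequality at coordinate \<open>i\<close>. The corrections
    \<open>p $ i - q $ i\<close> cancel in the sum because \<open>p\<close> and \<open>q\<close>
    have the same total mass.\<close>
  define d where "d i = p $ i * ln (p $ i / q $ i) - (p $ i - q $ i)" for i
  have p_nonneg: "0 \<le> p $ i" for i using p by (simp add: prob_vectors_def)
  have d_nonneg: "0 \<le> d i" for i
    using gibbs_term(1)[OF p_nonneg[of i] q_pos[of i]] by (simp add: d_def)
  have "sum d UNIV = - rel_entropy p q"
    using p q_sum by (simp add: d_def rel_entropy_def prob_vectors_def sum_subtractf)
  with nonneg have "sum d UNIV \<le> 0" by simp
  moreover have "0 \<le> sum d UNIV" using d_nonneg by (simp add: sum_nonneg)
  ultimately have "sum d UNIV = 0" by simp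
  then have "d i = 0" for i using d_nonneg by (simp add: sum_nonneg_eq_0_iff)
  then have "p $ i = q $ i" for i
    using gibbs_term(2)[OF p_nonneg[of i] q_pos[of i]] by (simp add: d_def)
  then show ?thesis by (simp add: vec_eq_iff)
qed

lemma rel_entropy_arg_max:
  fixes p q :: "real ^ 'm"
  assumes q_pos: "\<And>i. 0 < q $ i" and q_sum: "(\<Sum>i\<in>UNIV. q $ i) = 1"
    and max: "is_arg_max (\<lambda>p. rel_entropy p q) (\<lambda>p. p \<in> prob_vectors) p"
  shows "p = q"
proof (rule rel_entropy_nonneg_imp_eq[OF _ q_pos q_sum])
  show "p \<in> prob_vectors" using max by (simp add: is_arg_max_def)
  \<comment> \<open>The generator is itself a competitor, with relative entropy 0, so the maximum is
    nonnegative.\<close>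
  have "q \<in> prob_vectors" using q_pos q_sum by (simp add: prob_vectors_def less_imp_le)
  then have "rel_entropy q q \<le> rel_entropy p q"
    using max by (auto simp: is_arg_max_def not_less)
  moreover have "rel_entropy q q = 0"
    using q_pos by (simp add: rel_entropy_def less_imp_neq[symmetric])
  ultimately show "0 \<le> rel_entropy p q" by simp
qed

text \<open>Gathers the contribution of each coordinate into one factor, so that the factors of
  \<open>i\<close> and \<open>j\<close> can be split off below.\<close>

lemma occ_prob_eq:
  "occ_prob \<nu> q = fact (\<Sum>i\<in>UNIV. \<nu> $ i) * (\<Prod>i\<in>UNIV. (q $ i) ^ (\<nu> $ i) / fact (\<nu> $ i))"
  by (simp add: occ_prob_def prod_dividef)

lemma occ_prob_arg_max_exchange:
  fixes q :: "real ^ 'm" and \<nu> :: "nat ^ 'm"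
  assumes q_pos: "\<And>i. 0 < q $ i"
    and max: "is_arg_max (\<lambda>\<nu>. occ_prob \<nu> q) (\<lambda>\<nu>. \<nu> \<in> occurrence_vectors n) \<nu>"
  shows "q $ j * real (\<nu> $ i) \<le> q $ i * (real (\<nu> $ j) + 1)"
proof (cases "i = j \<or> \<nu> $ i = 0")
  \<comment> \<open>If \<open>\<nu> $ i = 0\<close>, there is no draw to move, but the left-hand
    side vanishes.\<close>
  case True
  then show ?thesis using q_pos[of i] by (auto simp: algebra_simps)
next
  case False
  then obtain k where ij: "i \<noteq> j" and k: "\<nu> $ i = Suc k"
    by (auto simp: gr0_conv_Suc)
  define l where "l = \<nu> $ j"
  \<comment> \<open>The competitor: \<open>\<nu>\<close> with one draw moved from \<open>i\<close>
    to \<open>j\<close>, so the total stays \<open>n\<close>.\<close>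
  define \<mu> where "\<mu> = (\<chi> h. if h = i then k else if h = j then Suc l else \<nu> $ h)"
  define R where "R = (\<Prod>h\<in>UNIV - {i} - {j}. (q $ h) ^ (\<nu> $ h) / fact (\<nu> $ h))"
  have sum_split: "(\<Sum>h\<in>UNIV. f h) = f i + (f j + (\<Sum>h\<in>UNIV - {i} - {j}. f h))"
    for f :: "'m \<Rightarrow> nat"
    using ij by (simp add: sum.remove[of UNIV i] sum.remove[of "UNIV - {i}" j])
  have prod_split: "(\<Prod>h\<in>UNIV. f h) = f i * (f j * (\<Prod>h\<in>UNIV - {i} - {j}. f h))"
    for f :: "'m \<Rightarrow> real"
    using ij by (simp add: prod.remove[of UNIV i] prod.remove[of "UNIV - {i}" j])
  have sum_\<nu>: "(\<Sum>h\<in>UNIV. \<nu> $ h) = n"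
    using max by (simp add: is_arg_max_def occurrence_vectors_def)
  have "(\<Sum>h\<in>UNIV. \<mu> $ h) = (\<Sum>h\<in>UNIV. \<nu> $ h)"
    unfolding sum_split using ij k by (simp add: \<mu>_def l_def)
  with sum_\<nu> have sum_\<mu>: "(\<Sum>h\<in>UNIV. \<mu> $ h) = n" by simp
  have "\<mu> \<in> occurrence_vectors n" using sum_\<mu> by (simp add: occurrence_vectors_def)
  then have le: "occ_prob \<mu> q \<le> occ_prob \<nu> q"
    using max by (auto simp: is_arg_max_def not_less)
  have R_pos: "0 < R" using q_pos by (auto simp: R_def intro!: prod_pos)
  have R_\<mu>: "(\<Prod>h\<in>UNIV - {i} - {j}. (q $ h) ^ (\<mu> $ h) / fact (\<mu> $ h)) = R"
    unfolding R_def by (rule prod.cong) (auto simp: \<mu>_def)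
  \<comment> \<open>The common part of both probabilities, with \<open>k\<close> draws at
    \<open>i\<close> and \<open>l\<close> at \<open>j\<close>. The one remaining draw contributes
    \<open>q $ j / (l + 1)\<close> for \<open>\<mu>\<close> and \<open>q $ i / (k + 1)\<close> for
    \<open>\<nu>\<close>.\<close>
  define C where "C = fact n * ((q $ i) ^ k / fact k) * ((q $ j) ^ l / fact l) * R"
  have C_pos: "0 < C" using q_pos R_pos by (simp add: C_def)
  have "occ_prob \<mu> q = C * (q $ j / (real l + 1))"
    unfolding occ_prob_eq sum_\<mu> prod_split R_\<mu>
    using ij by (simp add: \<mu>_def C_def mult_ac add.commute)
  moreover have "occ_prob \<nu> q = C * (q $ i / (real k + 1))"
    unfolding occ_prob_eq sum_\<nu> prod_split R_def[symmetric]
    using ij k by (simp add: C_def l_def mult_ac add.commute)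
  ultimately have "q $ j / (real l + 1) \<le> q $ i / (real k + 1)"
    using le C_pos by (metis mult_le_cancel_left_pos)
  then show ?thesis using k by (simp add: l_def field_simps)
qed

lemma occ_prob_arg_max_bound:
  fixes q :: "real ^ 'm" and \<nu> :: "nat ^ 'm"
  assumes q_pos: "\<And>i. 0 < q $ i" and q_sum: "(\<Sum>i\<in>UNIV. q $ i) = 1"
    and max: "is_arg_max (\<lambda>\<nu>. occ_prob \<nu> q) (\<lambda>\<nu>. \<nu> \<in> occurrence_vectors n) \<nu>"
  shows "\<bar>real (\<nu> $ i) - real n * q $ i\<bar> \<le> real CARD('m)"
proof -
  note exchange = occ_prob_arg_max_exchange[OF q_pos max]
  have sum_\<nu>: "(\<Sum>h\<in>UNIV. real (\<nu> $ h)) = real n"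
    using max by (simp add: is_arg_max_def occurrence_vectors_def flip: of_nat_sum)
  \<comment> \<open>Here the source \<open>i\<close> is fixed and the target \<open>j\<close>
    varies, so the \<open>+ 1\<close> is counted once per coordinate.\<close>
  have "(\<Sum>j\<in>UNIV. q $ j * real (\<nu> $ i)) \<le> (\<Sum>j\<in>UNIV. q $ i * (real (\<nu> $ j) + 1))"
    by (intro sum_mono exchange)
  then have upper: "real (\<nu> $ i) \<le> q $ i * (real n + real CARD('m))"
    by (simp add: q_sum sum_\<nu> sum.distrib flip: sum_distrib_left sum_distrib_right)
  \<comment> \<open>Now the target is fixed and the sources vary; the \<open>+ 1\<close> is weighted
    by \<open>q\<close>, so it adds only 1.\<close>
  have "(\<Sum>j\<in>UNIV. q $ i * real (\<nu> $ j)) \<le> (\<Sum>j\<in>UNIV. q $ j * (real (\<nu> $ i) + 1))"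
    by (intro sum_mono exchange)
  then have lower: "q $ i * real n \<le> real (\<nu> $ i) + 1"
    by (simp add: q_sum sum_\<nu> flip: sum_distrib_left sum_distrib_right)
  \<comment> \<open>Both errors, \<open>q $ i * CARD('m)\<close> above and 1 below, are at most
    \<open>CARD('m)\<close>, a bound independent of \<open>n\<close>.\<close>
  have "q $ i \<le> (\<Sum>j\<in>UNIV. q $ j)"
    using q_pos by (intro member_le_sum) (auto intro: less_imp_le)
  then have "q $ i * real CARD('m) \<le> real CARD('m)"
    using q_pos by (simp add: q_sum mult_left_le_one_le less_imp_le)
  moreover have "1 \<le> real CARD('m)" by (simp add: Suc_leI)
  ultimately show ?thesis using upper lower unfolding distrib_left mult.commute[of "real n"] by linarith
qed

theorem theorem1:
  fixes q phat :: "real ^ 'm"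
    and nhat :: "nat \<Rightarrow> nat ^ 'm"
  assumes q_pos: "\<And>i. 0 < q $ i"
    and q_sum: "(\<Sum>i\<in>UNIV. q $ i) = 1"
    and nhat: "\<And>n. 1 \<le> n \<Longrightarrow>
      is_arg_max (\<lambda>\<nu>. occ_prob \<nu> q) (\<lambda>\<nu>. \<nu> \<in> occurrence_vectors n) (nhat n)"
    and phat: "is_arg_max (\<lambda>p. rel_entropy p q) (\<lambda>p. p \<in> prob_vectors) phat"
  shows "(\<lambda>n. \<chi> i. real (nhat n $ i) / real n) \<longlonglongrightarrow> phat"
proof -
  have "phat = q" by (rule rel_entropy_arg_max[OF q_pos q_sum phat])
  moreover have "(\<lambda>n. \<chi> i. real (nhat n $ i) / real n) \<longlonglongrightarrow> q"
  proof (rule vec_tendstoI)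
    fix i
    have "(\<lambda>n. real (nhat n $ i) / real n - q $ i) \<longlonglongrightarrow> 0"
    proof (rule Lim_null_comparison)
      show "(\<lambda>n. real CARD('m) / real n) \<longlonglongrightarrow> 0"
        by (rule lim_const_over_n)
      show "\<forall>\<^sub>F n in sequentially.
          norm (real (nhat n $ i) / real n - q $ i) \<le> real CARD('m) / real n"
        \<comment> \<open>Nothing is assumed about \<open>nhat 0\<close>, and the division needs
          \<open>n\<close> nonzero.\<close>
        using eventually_ge_at_top[of 1]
      proof eventually_elim
        case (elim n)
        have "real (nhat n $ i) / real n - q $ i = (real (nhat n $ i) - real n * q $ i) / real n"
          using elim by (simp add: field_simps)
        then show ?case
          using occ_prob_arg_max_bound[OF q_pos q_sum nhat[OF elim], of i]
          by (simp add: divide_right_mono)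
      qed
    qed
    then show "(\<lambda>n. (\<chi> i. real (nhat n $ i) / real n) $ i) \<longlonglongrightarrow> q $ i"
      by (simp add: LIM_zero_iff)
  qed
  ultimately show ?thesis by simp
qed

end
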